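(* For each integer $N\ge 3$ let $R^\star_\infty=R^\star_\infty(N)$ be the minimum number of rounds $R\in\mathbb N$ for which a bidirectionally feasible schedule $\bm X\in\{0,1\}^{R\times(N-1)}$ exists (with no concurrency limit); equivalently, $R^\star_\infty(N)=\min\{R\in\mathbb N:\binom{R}{\lfloor R/2\rfloor}\ge N-1\}$. Then, as $N\to\infty$, $$R^\star_\infty=\log_2(N-1)+\frac12\log_2\log_2(N-1)+\mathcal O(1).$$
   Context: $\mathbb N$ is the set of positive integers. A schedule with $R$ rounds for an $N$-node network is a binary matrix $\bm X=[\bm\chi_2,\dots,\bm\chi_N]\in\{0,1\}^{R\times(N-1)}$ whose columns are the codewords $\bm\chi_n=[\chi_{n,1},\dots,\chi_{n,R}]^{\mathrm T}$ of the non-reference nodes $2,\dots,N$ ($\chi_{n,r}=1$: node $n$ transmits in round $r$; $\chi_{n,r}=0$: it listens). It is bidirectionally feasible if $\sum_{r=1}^R\chi_{n_1,r}(1-\chi_{n_2,r})\ge 1$ for all ordered pairs of distinct $n_1,n_2\in\{2,\dots,N\}$. *)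

theory Defs
  imports Complex_Main "HOL-Library.Landau_Symbols"
begin

text \<open>
  A matrix in {0,1}^(R x (N-1)) is a function X of the round r and the node n; only
  1 \<le> r \<le> R and 2 \<le> n \<le> N matter, and X r n is the entry chi_(n,r).
  The entries are integers, so that 1 - X r n is not truncated subtraction.
\<close>

definition schedule :: "nat \<Rightarrow> nat \<Rightarrow> (nat \<Rightarrow> nat \<Rightarrow> int) \<Rightarrow> bool" where
  "schedule R N X \<longleftrightarrow> (\<forall>r\<in>{1..R}. \<forall>n\<in>{2..N}. X r n \<in> {0, 1})"

definition bidirectionally_feasible :: "nat \<Rightarrow> nat \<Rightarrow> (nat \<Rightarrow> nat \<Rightarrow> int) \<Rightarrow> bool" where
  "bidirectionally_feasible R N X \<longleftrightarrow>
     (\<forall>n1\<in>{2..N}. \<forall>n2\<in>{2..N}. n1 \<noteq> n2 \<longrightarrow> (\<Sum>r=1..R. X r n1 * (1 - X r n2)) \<ge> 1)"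

definition feasible_rounds :: "nat \<Rightarrow> nat set" where
  "feasible_rounds N =
     {R. R \<ge> 1 \<and> (\<exists>X. schedule R N X \<and> bidirectionally_feasible R N X)}"

definition R_star :: "nat \<Rightarrow> nat" where
  "R_star N = (LEAST R. R \<in> feasible_rounds N)"

end

(*
  Column n of a schedule is the set of rounds in which node n transmits; feasibility says that
  these sets are pairwise incomparable, so by Sperner's theorem R rounds suffice iff
  N - 1 \<le> R choose (R div 2).  Sperner's theorem follows from the Lubell-Yamamoto-Meshalkin
  inequality, proved by induction on the ground set: sum the inequality over the subfamilies
  avoiding one point.  The asymptotics come from R * c^2 \<le> 4^R \<le> 2 * (R + 1) * c^2 for the
  central binomial coefficient c: with M = N - 1 the error term lies in [0, 3] for all N \<ge> 3.
*)
theory Submission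
  imports Defs
begin

section \<open>Sperner's theorem\<close>

lemma lym_inequality:
  fixes F :: "'a set set"
  assumes "finite S" "F \<subseteq> Pow S" "\<And>A B. A \<in> F \<Longrightarrow> B \<in> F \<Longrightarrow> A \<subseteq> B \<Longrightarrow> A = B"
  shows "(\<Sum>A\<in>F. 1 / real (card S choose card A)) \<le> 1"
  using assms
proof (induction "card S" arbitrary: S F)
  case 0
  then have "F \<subseteq> {{}}" by auto
  then have "F = {} \<or> F = {{}}" by blast
  then show ?case using 0 by auto
next
  case (Suc n)
  show ?case
  \<comment> \<open>The full set avoids no point, so the averaging below would miss it; being
    comparable to every member, it has to be handled as the only one.\<close>
  proof (cases "S \<in> F")
    case True
    then have "F = {S}" using Suc.prems by blast
    then show ?thesis by simp
  next
    case False
    have finF: "finite F" using Suc.prems(1,2) by (meson finite_Pow_iff finite_subset)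
    \<comment> \<open>Double counting: with k = \<open>card A\<close>, the set A survives for the
      \<open>Suc n\<close> - k points outside it, and (\<open>Suc n\<close> - k) / (n choose k) =
      \<open>Suc n\<close> / (\<open>Suc n\<close> choose k). Hence every member's weight is scaled
      by the same factor \<open>Suc n\<close>.\<close>
    have weight: "(\<Sum>x\<in>S. if x \<notin> A then 1 / real (n choose card A) else 0)
        = real (Suc n) * (1 / real (card S choose card A))" if "A \<in> F" for A
    proof -
      have A: "A \<subseteq> S" "A \<noteq> S" using that Suc.prems False by auto
      then have "card A < card S" using Suc.prems(1) by (simp add: psubset_card_mono psubsetI)
      then have le: "card A \<le> n" using Suc.hyps(2) by simp
      have "real (Suc n - card A) * real (Suc n choose card A) = real (Suc n) * real (n choose card A)"
        using binomial_absorb_comp[of "Suc n" "card A"] by (metis diff_Suc_1 of_nat_mult)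
      moreover have "real (n choose card A) > 0" "real (Suc n choose card A) > 0"
        using le by simp_all
      ultimately have "real (Suc n - card A) / real (n choose card A)
          = real (Suc n) / real (Suc n choose card A)"
        by (simp add: frac_eq_eq del: binomial_Suc_Suc of_nat_Suc)
      moreover have "(\<Sum>x\<in>S. if x \<notin> A then 1 / real (n choose card A) else 0)
          = (\<Sum>x\<in>S - A. 1 / real (n choose card A))"
        using Suc.prems(1) by (intro sum.mono_neutral_cong_right) auto
      moreover have "card (S - A) = Suc n - card A"
        using A Suc.prems(1) Suc.hyps(2) by (simp add: card_Diff_subset finite_subset)
      ultimately show ?thesis
        using Suc.hyps(2) by simp
    qed
    have "real (Suc n) * (\<Sum>A\<in>F. 1 / real (card S choose card A))
        = (\<Sum>A\<in>F. \<Sum>x\<in>S. if x \<notin> A then 1 / real (n choose card A) else 0)"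
      unfolding sum_distrib_left using weight by (intro sum.cong) simp_all
    also have "\<dots> = (\<Sum>x\<in>S. \<Sum>A\<in>F. if x \<notin> A then 1 / real (n choose card A) else 0)"
      by (rule sum.swap)
    also have "\<dots> \<le> (\<Sum>x\<in>S. 1)"
    proof (rule sum_mono)
      fix x assume x: "x \<in> S"
      have cS: "card (S - {x}) = n" using x Suc.hyps(2) Suc.prems(1) by simp
      have "(\<Sum>A\<in>F. if x \<notin> A then 1 / real (n choose card A) else 0)
          = (\<Sum>A\<in>{A\<in>F. x \<notin> A}. 1 / real (n choose card A))"
        using finF by (intro sum.mono_neutral_cong_right) auto
      also have "\<dots> \<le> 1"
        using Suc.hyps(1)[of "S - {x}" "{A\<in>F. x \<notin> A}"] cS Suc.prems by auto
      finally show "(\<Sum>A\<in>F. if x \<notin> A then 1 / real (n choose card A) else 0) \<le> 1" .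
    qed
    also have "\<dots> = real (Suc n) * 1" using Suc.hyps(2) by simp
    finally show ?thesis by (simp only: mult_le_cancel_left_pos of_nat_0_less_iff zero_less_Suc)
  qed
qed

text \<open>The central coefficient is the largest, so each term of the LYM sum is at least 1 /
  \<open>?c\<close>.\<close>

theorem sperner:
  fixes F :: "'a set set"
  assumes "finite S" "F \<subseteq> Pow S" "\<And>A B. A \<in> F \<Longrightarrow> B \<in> F \<Longrightarrow> A \<subseteq> B \<Longrightarrow> A = B"
  shows "card F \<le> card S choose (card S div 2)"
proof -
  let ?c = "card S choose (card S div 2)"
  have c: "?c > 0" by simp
  have "real (card F) / real ?c = (\<Sum>A\<in>F. 1 / real ?c)" by simp
  also have "\<dots> \<le> (\<Sum>A\<in>F. 1 / real (card S choose card A))"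
  proof (rule sum_mono)
    fix A assume "A \<in> F"
    then have "card A \<le> card S" using assms by (auto intro: card_mono)
    then have "card S choose card A > 0" by simp
    then show "1 / real ?c \<le> 1 / real (card S choose card A)"
      using binomial_maximum[of "card S" "card A"] by (intro divide_left_mono) auto
  qed
  also have "\<dots> \<le> 1" using assms by (rule lym_inequality)
  finally show ?thesis using c by (simp add: divide_le_eq)
qed

section \<open>Feasible schedules as antichains\<close>

lemma feasible_rounds_iff:
  "R \<in> feasible_rounds N \<longleftrightarrow> R \<ge> 1 \<and> N - 1 \<le> R choose (R div 2)"
proof
  assume "R \<in> feasible_rounds N"
  then obtain X where R: "R \<ge> 1" and X: "schedule R N X" "bidirectionally_feasible R N X"
    by (auto simp: feasible_rounds_def)
  define f where "f n = {r\<in>{1..R}. X r n = 1}" for n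
  have incomparable: "n1 = n2" if n: "n1 \<in> {2..N}" "n2 \<in> {2..N}" and sub: "f n1 \<subseteq> f n2" for n1 n2
  proof (rule ccontr)
    assume "n1 \<noteq> n2"
    then have "(\<Sum>r=1..R. X r n1 * (1 - X r n2)) \<ge> 1"
      using X(2) n by (auto simp: bidirectionally_feasible_def)
    \<comment> \<open>A nonzero summand would be a round in which \<open>n1\<close> transmits and
      \<open>n2\<close> listens, that is, an element of \<open>f n1\<close> outside
      \<open>f n2\<close>.\<close>
    moreover have "X r n1 * (1 - X r n2) = 0" if "r \<in> {1..R}" for r
    proof -
      have "X r n1 \<in> {0, 1}" using X(1) n that by (auto simp: schedule_def)
      then show ?thesis using sub that by (auto simp: f_def)
    qed
    ultimately show False by simp
  qed
  then have "inj_on f {2..N}" by (intro inj_onI) auto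
  then have "N - 1 = card (f ` {2..N})" by (simp add: card_image)
  also have "\<dots> \<le> card {1..R} choose (card {1..R} div 2)"
  proof (rule sperner)
    show "f ` {2..N} \<subseteq> Pow {1..R}" by (auto simp: f_def)
    show "A = B" if "A \<in> f ` {2..N}" "B \<in> f ` {2..N}" "A \<subseteq> B" for A B
      using that incomparable by blast
  qed simp
  finally show "R \<ge> 1 \<and> N - 1 \<le> R choose (R div 2)" using R by simp
next
  assume R: "R \<ge> 1 \<and> N - 1 \<le> R choose (R div 2)"
  \<comment> \<open>The middle layer is an antichain of the largest size: finite sets of equal
    cardinality are equal once one contains the other.\<close>
  let ?L = "{A. A \<subseteq> {1..R} \<and> card A = R div 2}"
  have "card {2..N} \<le> card ?L" using R by (simp add: n_subsets)
  then obtain f where f: "inj_on f {2..N}" "f ` {2..N} \<subseteq> ?L"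
    using card_le_inj[of "{2..N}" ?L] by auto
  define X :: "nat \<Rightarrow> nat \<Rightarrow> int" where "X r n = (if r \<in> f n then 1 else 0)" for r n
  have "(\<Sum>r=1..R. X r n1 * (1 - X r n2)) \<ge> 1"
    if n: "n1 \<in> {2..N}" "n2 \<in> {2..N}" "n1 \<noteq> n2" for n1 n2
  proof -
    have layer: "f n1 \<in> ?L" "f n2 \<in> ?L" using f(2) n by blast+
    have ne: "f n1 \<noteq> f n2" using f(1) n by (meson inj_onD)
    have "\<not> f n1 \<subseteq> f n2"
      using layer ne card_subset_eq[of "f n2" "f n1"] finite_subset[of "f n2" "{1..R}"] by auto
    then obtain r where r: "r \<in> f n1" "r \<notin> f n2" by blast
    then have "r \<in> {1..R}" using layer by auto
    moreover have "X r n1 * (1 - X r n2) = 1" using r by (simp add: X_def)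
    ultimately show ?thesis
      using member_le_sum[of r "{1..R}" "\<lambda>r. X r n1 * (1 - X r n2)"] by (auto simp: X_def)
  qed
  then have "bidirectionally_feasible R N X" by (simp add: bidirectionally_feasible_def)
  moreover have "schedule R N X" by (simp add: schedule_def X_def)
  ultimately show "R \<in> feasible_rounds N" using R by (auto simp: feasible_rounds_def)
qed

text \<open>Makes the \<open>LEAST\<close> in \<open>R_star\<close> an attained minimum; N choose 1
  = N already exceeds N - 1.\<close>

lemma feasible_rounds_self:
  assumes "N \<ge> 1"
  shows "N \<in> feasible_rounds N"
  using assms binomial_maximum[of N 1] by (simp add: feasible_rounds_iff)

section \<open>Central binomial coefficients\<close>

text \<open>Pascal's rule splits the right side into two coefficients that are equal by symmetry.
  This reduces odd R to even R + 1.\<close>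

lemma central_binomial_odd:
  "2 * ((2 * m + 1) choose m) = (2 * m + 2) choose (m + 1)"
  using binomial_symmetric[of m "2 * m + 1"] by simp

lemma central_binomial_rec:
  "(m + 1) * ((2 * m + 2) choose (m + 1)) = 2 * (2 * m + 1) * ((2 * m) choose m)"
proof -
  have "(m + 1) * ((2 * m + 1) choose (m + 1)) = (2 * m + 1) * ((2 * m) choose m)"
    using Suc_times_binomial[of m "2 * m"] by simp
  moreover have "(2 * m + 1) choose (m + 1) = (2 * m + 1) choose m"
    using binomial_symmetric[of m "2 * m + 1"] by simp
  ultimately show ?thesis
    unfolding central_binomial_odd[symmetric] by (simp add: mult_ac)
qed

text \<open>The coefficient grows like 4^m / sqrt m; squaring removes the root, so that both bounds
  become inductions with polynomial factors.\<close>

lemma central_binomial_square_rec: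
  "(real m + 1)\<^sup>2 * (real ((2 * Suc m) choose Suc m))\<^sup>2
     = 4 * (2 * real m + 1)\<^sup>2 * (real ((2 * m) choose m))\<^sup>2"
proof -
  have "(real m + 1) * real ((2 * Suc m) choose Suc m)
      = 2 * (2 * real m + 1) * real ((2 * m) choose m)"
    using arg_cong[OF central_binomial_rec[of m], of real]
    by (simp add: algebra_simps del: binomial_Suc_Suc)
  then show ?thesis
    by (metis (no_types, lifting) power_mult_distrib four_x_squared power2_eq_square mult.assoc)
qed

text \<open>The induction step comes down to (2m + 1)(2m + 3) \<le> 4(m + 1)^2.\<close>

lemma central_binomial_even_upper:
  "(2 * real m + 1) * (real ((2 * m) choose m))\<^sup>2 \<le> 16 ^ m"
proof (induction m)
  case (Suc m)
  let ?c = "real ((2 * m) choose m)" and ?d = "real ((2 * Suc m) choose Suc m)"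
  have "(real m + 1)\<^sup>2 * ((2 * real (Suc m) + 1) * ?d\<^sup>2)
      = (2 * real m + 3) * ((real m + 1)\<^sup>2 * ?d\<^sup>2)" by (simp add: algebra_simps del: binomial_Suc_Suc)
  also have "\<dots> = (4 * (2 * real m + 3) * (2 * real m + 1)) * ((2 * real m + 1) * ?c\<^sup>2)"
    unfolding central_binomial_square_rec by (simp add: power2_eq_square)
  also have "\<dots> \<le> (16 * (real m + 1)\<^sup>2) * 16 ^ m"
  proof (rule mult_mono)
    show "4 * (2 * real m + 3) * (2 * real m + 1) \<le> 16 * (real m + 1)\<^sup>2"
      by (simp add: power2_eq_square algebra_simps)
  qed (use Suc.IH in auto)
  finally have "(real m + 1)\<^sup>2 * ((2 * real (Suc m) + 1) * ?d\<^sup>2) \<le> (real m + 1)\<^sup>2 * 16 ^ Suc m"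
    by (simp add: mult_ac del: binomial_Suc_Suc)
  then show ?case
    by (subst (asm) mult_le_cancel_left_pos) (auto simp: add_pos_nonneg)
qed simp

text \<open>The induction step comes down to 4m(m + 1) \<le> (2m + 1)^2. The bound fails at m = 0
  and is an equality at m = 1.\<close>

lemma central_binomial_even_lower:
  "m \<ge> 1 \<Longrightarrow> 16 ^ m \<le> 4 * real m * (real ((2 * m) choose m))\<^sup>2"
proof (induction m rule: dec_induct)
  case base
  then show ?case by simp
next
  case (step m)
  let ?c = "real ((2 * m) choose m)" and ?d = "real ((2 * Suc m) choose Suc m)"
  have "(real m + 1)\<^sup>2 * 16 ^ Suc m = 16 * (real m + 1)\<^sup>2 * 16 ^ m" by simp
  also have "\<dots> \<le> 16 * (real m + 1)\<^sup>2 * (4 * real m * ?c\<^sup>2)"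
    using step.IH by (intro mult_left_mono) auto
  also have "\<dots> = 16 * (real m + 1) * ?c\<^sup>2 * (4 * (real m * (real m + 1)))"
    by (simp add: power2_eq_square)
  also have "\<dots> \<le> 16 * (real m + 1) * ?c\<^sup>2 * (2 * real m + 1)\<^sup>2"
    by (intro mult_left_mono) (auto simp: power2_eq_square algebra_simps)
  also have "\<dots> = 4 * (real m + 1) * ((real m + 1)\<^sup>2 * ?d\<^sup>2)"
    unfolding central_binomial_square_rec by simp
  also have "\<dots> = (real m + 1)\<^sup>2 * (4 * real (Suc m) * ?d\<^sup>2)"
    by (simp add: mult_ac del: binomial_Suc_Suc)
  finally show ?case
    by (subst (asm) mult_le_cancel_left_pos) (auto simp: add_pos_nonneg)
qed

text \<open>The factors are chosen to serve both parities: the upper bound has slack R + 1 (even) or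
  R + 2 (odd) in place of R, and 2(R + 1) is what the odd case gives and also covers R = 0.\<close>

lemma central_binomial_bounds:
  fixes R :: nat
  defines "c \<equiv> real (R choose (R div 2))"
  shows "real R * c\<^sup>2 \<le> 4 ^ R" and "4 ^ R \<le> 2 * (real R + 1) * c\<^sup>2"
proof -
  have "real R * c\<^sup>2 \<le> 4 ^ R \<and> 4 ^ R \<le> 2 * (real R + 1) * c\<^sup>2"
  proof (cases "even R")
    case True
    then obtain m where R: "R = 2 * m" by auto
    have c: "c = real ((2 * m) choose m)" by (simp add: c_def R)
    have pow: "(4::real) ^ R = 16 ^ m" by (simp add: R power_mult)
    have "real R * c\<^sup>2 \<le> (2 * real m + 1) * c\<^sup>2" by (intro mult_right_mono) (auto simp: R)
    also have "\<dots> \<le> 4 ^ R" unfolding pow c by (rule central_binomial_even_upper)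
    finally have "real R * c\<^sup>2 \<le> 4 ^ R" .
    moreover have "4 ^ R \<le> 2 * (real R + 1) * c\<^sup>2"
    proof (cases "m = 0")
      case True
      then show ?thesis by (simp add: R c)
    next
      case False
      then have "4 ^ R \<le> 4 * real m * c\<^sup>2"
        unfolding pow c by (intro central_binomial_even_lower) simp
      also have "\<dots> \<le> 2 * (real R + 1) * c\<^sup>2" by (intro mult_right_mono) (auto simp: R)
      finally show ?thesis .
    qed
    ultimately show ?thesis by simp
  next
    case False
    then obtain m where R: "R = 2 * m + 1" by (auto elim: oddE)
    \<comment> \<open>Twice an odd central coefficient is the next even one, so the even bounds at
      \<open>Suc m\<close> apply; the factor 4 from squaring cancels against 16^(m + 1) = 4 *
      4^R.\<close>
    have "2 * c = real ((2 * Suc m) choose Suc m)"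
      using arg_cong[OF central_binomial_odd[of m], of real] by (simp add: c_def R del: binomial_Suc_Suc)
    then have c: "(real ((2 * Suc m) choose Suc m))\<^sup>2 = 4 * c\<^sup>2" by (metis four_x_squared)
    have pow: "(16::real) ^ Suc m = 4 * 4 ^ R" by (simp add: R power_mult)
    have "(real R + 2) * c\<^sup>2 \<le> 4 ^ R"
      using central_binomial_even_upper[of "Suc m"] unfolding c pow by (simp add: R algebra_simps)
    moreover have "real R * c\<^sup>2 \<le> (real R + 2) * c\<^sup>2" by (intro mult_right_mono) auto
    moreover have "4 ^ R \<le> 2 * (real R + 1) * c\<^sup>2"
      using central_binomial_even_lower[of "Suc m"] unfolding c pow by (simp add: R algebra_simps)
    ultimately show ?thesis by linarith
  qed
  then show "real R * c\<^sup>2 \<le> 4 ^ R" and "4 ^ R \<le> 2 * (real R + 1) * c\<^sup>2" by auto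
qed

section \<open>Asymptotics of the optimal number of rounds\<close>

lemma R_star_error_bounds:
  assumes "N \<ge> 3"
  defines "M \<equiv> real N - 1"
  defines "T \<equiv> log 2 M + 1 / 2 * log 2 (log 2 M)"
  shows "T \<le> real (R_star N)" and "real (R_star N) \<le> T + 3"
proof -
  define R where "R = R_star N"
  have "N \<in> feasible_rounds N" using assms(1) by (intro feasible_rounds_self) simp
  then have feas: "R \<in> feasible_rounds N"
    unfolding R_def R_star_def by (rule LeastI)
  have R1: "R \<ge> 1" and upper: "N - 1 \<le> R choose (R div 2)"
    using feas by (auto simp: feasible_rounds_iff)
  \<comment> \<open>This keeps R - 1 \<ge> 1, so R - 1 can be infeasible only because its central
    coefficient is too small.\<close>
  have "R \<noteq> 1" using upper assms(1) by auto
  then have R2: "R \<ge> 2" using R1 by simp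
  have "R - 1 \<notin> feasible_rounds N"
    using R2 unfolding R_def R_star_def by (intro not_less_Least) simp
  then have lower: "(R - 1) choose ((R - 1) div 2) < N - 1"
    using R2 by (auto simp: feasible_rounds_iff)
  have M: "M = real (N - 1)" "M \<ge> 2" using assms by auto
  have L: "log 2 M \<ge> 1" using M(2) by (simp add: le_log_iff)

  have "real R * M\<^sup>2 \<le> real R * (real (R choose (R div 2)))\<^sup>2"
    using upper M by (intro mult_left_mono power_mono) auto
  also have "\<dots> \<le> 4 ^ R" by (rule central_binomial_bounds)
  finally have "log 2 (real R * M\<^sup>2) \<le> log 2 (4 ^ R)"
    using R2 M by (subst log_le_cancel_iff) auto
  moreover have log4: "log 2 (4 ^ k) = 2 * real k" for k :: nat
    using log_pow_cancel[of 2 "2 * k"] by (simp add: power_mult)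
  moreover have "log 2 (real R * M\<^sup>2) = log 2 (real R) + 2 * log 2 M"
    using R2 M(2) by (simp add: log_mult log_nat_power)
  ultimately have low: "log 2 M + 1 / 2 * log 2 (real R) \<le> real R" by simp
  \<comment> \<open>The bound \<open>low\<close> is fed back into itself: it yields R \<ge> log M,
    hence log R may be replaced by log log M.\<close>
  have "log 2 (real R) \<ge> 0" using R2 by simp
  then have "log 2 M \<le> real R" using low by simp
  then have "log 2 (log 2 M) \<le> log 2 (real R)" using L by simp
  then show "T \<le> real (R_star N)" using low by (simp add: T_def R_def)

  \<comment> \<open>The upper bound uses minimality: the central coefficient for R - 1 is still
    below M.\<close>
  have "4 ^ (R - 1) \<le> 2 * (real (R - 1) + 1) * (real ((R - 1) choose ((R - 1) div 2)))\<^sup>2"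
    by (rule central_binomial_bounds)
  also have "\<dots> \<le> 2 * real R * M\<^sup>2"
    using lower M R2 by (intro mult_mono power_mono) auto
  finally have "log 2 (4 ^ (R - 1)) \<le> log 2 (2 * real R * M\<^sup>2)"
    using R2 M by (subst log_le_cancel_iff) auto
  moreover have "log 2 (2 * real R * M\<^sup>2) = 1 + log 2 (real R) + 2 * log 2 M"
    using R2 M(2) by (simp add: log_mult log_nat_power)
  ultimately have up: "real R \<le> 3 / 2 + log 2 M + 1 / 2 * log 2 (real R)"
    using R2 by (simp add: log4)
  \<comment> \<open>Bootstrapping: this crude estimate turns \<open>up\<close> into R \<le> 3 + 2
    log M, which is at most 8 log M because log M \<ge> 1. The power of two 8 contributes exactly 3
    to log R, so the total constant is 3/2 + 3/2 = 3.\<close>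
  have "log 2 (real R) \<le> real R"
    using R2 less_exp[of R] by (simp add: log_le_iff powr_realpow)
  then have "real R \<le> 8 * log 2 M" using up L by simp
  then have "log 2 (real R) \<le> log 2 (8 * log 2 M)" using R2 L by simp
  also have "\<dots> = 3 + log 2 (log 2 M)"
    using L log_pow_cancel[of 2 3] by (simp add: log_mult)
  finally show "real (R_star N) \<le> T + 3" using up by (simp add: T_def R_def)
qed

theorem corollary1:
  shows "(\<forall>N\<ge>3. feasible_rounds N \<noteq> {} \<and>
            R_star N = (LEAST R. R \<ge> 1 \<and> R choose (R div 2) \<ge> N - 1)) \<and>
         (\<lambda>N. real (R_star N) -
            (log 2 (real N - 1) + 1 / 2 * log 2 (log 2 (real N - 1)))) \<in> O(\<lambda>N. 1)"
proof
  show "\<forall>N\<ge>3. feasible_rounds N \<noteq> {} \<and>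
      R_star N = (LEAST R. R \<ge> 1 \<and> R choose (R div 2) \<ge> N - 1)"
  proof (intro allI impI conjI)
    fix N :: nat assume "3 \<le> N"
    then have "N \<in> feasible_rounds N" by (intro feasible_rounds_self) simp
    then show "feasible_rounds N \<noteq> {}" by blast
    show "R_star N = (LEAST R. R \<ge> 1 \<and> R choose (R div 2) \<ge> N - 1)"
      by (simp add: R_star_def feasible_rounds_iff)
  qed
  show "(\<lambda>N. real (R_star N) -
      (log 2 (real N - 1) + 1 / 2 * log 2 (log 2 (real N - 1)))) \<in> O(\<lambda>N. 1)"
  proof (rule bigoI)
    show "\<forall>\<^sub>F N in at_top. norm (real (R_star N) -
        (log 2 (real N - 1) + 1 / 2 * log 2 (log 2 (real N - 1)))) \<le> 3 * norm (1::real)"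
      using eventually_ge_at_top[of 3]
    proof eventually_elim
      case (elim N)
      then show ?case
        using R_star_error_bounds[of N] by simp
    qed
  qed
qed

end
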